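(* Let $k\geq 5$ be an integer and let $G$ be a finite connected graph of order at least $k$. Then $$\operatorname{sdiam}_k(G)\leq \frac{k+3}{k+1}\,\operatorname{srad}_k(G).$$
   Context: Graphs are finite, simple and undirected. The order of a graph is its number of vertices, and its size is its number of edges. For a connected graph $G$ and a non-empty set $S\subseteq V(G)$, the Steiner distance $d(S)$ is the minimum size (number of edges) of a connected subgraph of $G$ containing all vertices of $S$. For an integer $k$ with $2\le k\le |V(G)|$ and $v\in V(G)$, the Steiner $k$-eccentricity of $v$ is $\operatorname{e}_k(v)=\max\{d(S): S\subseteq V(G),\ |S|=k,\ v\in S\}$. The Steiner $k$-radius is $\operatorname{srad}_k(G)=\min\{\operatorname{e}_k(v):v\in V(G)\}$ and the Steiner $k$-diameter is $\operatorname{sdiam}_k(G)=\max\{\operatorname{e}_k(v):v\in V(G)\}$. *)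

theory Defs
  imports Complex_Main "Graph_Theory.Digraph_Component"
begin

text \<open>
  A finite simple undirected graph is a \<open>pair_graph\<close>: a finite loopfree digraph with a
  symmetric arc relation, so an undirected edge is a pair of opposite arcs. Its size therefore
  counts the unordered pairs of ends, not the arcs.
\<close>

definition graph_size :: "'a pair_pre_digraph \<Rightarrow> nat" where
  "graph_size G = card ((\<lambda>(u, v). {u, v}) ` parcs G)"

text \<open>
  \<open>subgraph\<close> alone would allow digraphs containing only one of two opposite arcs; requiring
  \<open>pair_graph H\<close> restricts it to subgraphs in the undirected sense. The theory name in
  \<open>Digraph_Component.connected\<close> excludes the topological notion.
\<close>

definition connected_subgraphs_containing ::
    "'a pair_pre_digraph \<Rightarrow> 'a set \<Rightarrow> 'a pair_pre_digraph set" where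
  "connected_subgraphs_containing G S =
     {H. pair_graph H \<and> subgraph (with_proj H) (with_proj G) \<and>
         Digraph_Component.connected (with_proj H) \<and> S \<subseteq> pverts H}"

definition steiner_dist :: "'a pair_pre_digraph \<Rightarrow> 'a set \<Rightarrow> nat" where
  "steiner_dist G S = Min (graph_size ` connected_subgraphs_containing G S)"

definition steiner_ecc :: "nat \<Rightarrow> 'a pair_pre_digraph \<Rightarrow> 'a \<Rightarrow> nat" where
  "steiner_ecc k G v =
     Max (steiner_dist G ` {S. S \<subseteq> pverts G \<and> card S = k \<and> v \<in> S})"

definition srad :: "nat \<Rightarrow> 'a pair_pre_digraph \<Rightarrow> nat" where
  "srad k G = Min (steiner_ecc k G ` pverts G)"

definition sdiam :: "nat \<Rightarrow> 'a pair_pre_digraph \<Rightarrow> nat" where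
  "sdiam k G = Max (steiner_ecc k G ` pverts G)"

text \<open>
  The sets under \<open>Min\<close> and \<open>Max\<close> above are finite and nonempty for the arguments of interest.
\<close>

lemma finite_connected_subgraphs_containing:
  assumes "pair_graph G"
  shows "finite (connected_subgraphs_containing G S)"
proof -
  interpret pair_graph G by fact
  let ?A = "(\<lambda>(V, E). \<lparr>pverts = V, parcs = E\<rparr>) ` (Pow (pverts G) \<times> Pow (parcs G))"
  have "finite ?A"
    using finite_verts finite_arcs by simp
  moreover have "connected_subgraphs_containing G S \<subseteq> ?A"
  proof
    fix H assume "H \<in> connected_subgraphs_containing G S"
    then have "pverts H \<subseteq> pverts G" "parcs H \<subseteq> parcs G"
      by (auto simp: connected_subgraphs_containing_def subgraph_def)
    then show "H \<in> ?A"
      by (intro image_eqI[of _ _ "(pverts H, parcs H)"]) auto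
  qed
  ultimately show ?thesis by (rule rev_finite_subset)
qed

lemma connected_subgraphs_containing_nonempty:
  assumes "pair_graph G" "Digraph_Component.connected (with_proj G)" "S \<subseteq> pverts G"
  shows "connected_subgraphs_containing G S \<noteq> {}"
proof -
  interpret pair_graph G by fact
  have "G \<in> connected_subgraphs_containing G S"
    using assms wf_digraph
    by (simp add: connected_subgraphs_containing_def subgraph_def compatible_def)
  then show ?thesis by blast
qed

lemma steiner_ecc_sets:
  assumes "pair_graph G" "v \<in> pverts G" "1 \<le> k" "k \<le> card (pverts G)"
  shows "finite {S. S \<subseteq> pverts G \<and> card S = k \<and> v \<in> S}" (is "finite ?F")
    and "{S. S \<subseteq> pverts G \<and> card S = k \<and> v \<in> S} \<noteq> {}"
proof -
  interpret pair_graph G by fact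
  have fin: "finite (pverts G)" using finite_verts by simp
  then show "finite ?F" by simp
  have "k - 1 \<le> card (pverts G - {v})"
    using assms fin by simp
  then obtain T where "T \<subseteq> pverts G - {v}" "card T = k - 1" "finite T"
    by (rule obtain_subset_with_card_n)
  then have "insert v T \<in> ?F" using assms by (auto simp: card_insert_if)
  then show "?F \<noteq> {}" by blast
qed

end

(*
  Let d(S) = r + d exceed the radius r, attained at a centre v. For s in S, joining a Steiner
  tree of S - {s} + {v} (size at most r) to s shows that s is at distance at least d from v;
  joining a Steiner tree of S - {s} (size at most m = r - l, for the largest such size) to s
  shows that the points of S are pairwise at distance at least d + l. Choose s with
  d(S - {s}) = m and take a Steiner tree T of S - {s} + {v}. The pendant path of T at v has
  length q <= l, since deleting it leaves a tree containing S - {s}. If it ends in a branch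
  point w, then w is at distance at least d - q from S, and going round the tree from w along
  two branches separately gives
    2r >= 2q + 4(d - q) + (k - 3)(d + l) >= (k + 1)d + (k - 5)l,
  which is where k >= 5 enters. If it ends in a point of S, then l >= q >= d and
  2r >= 2q + (k - 1)(d + l) suffices.
*)
theory Submission
  imports Defs
begin

section \<open>Connected vertex sets, described by cuts\<close>

text \<open>
  Connectedness of the subgraph induced by \<open>U\<close>, phrased by cuts. Since a spanning tree of
  \<open>U\<close> has \<open>card U - 1\<close> edges, Steiner distances can be computed with vertex sets alone.
\<close>

definition conn :: "'a rel \<Rightarrow> 'a set \<Rightarrow> bool" where
  "conn E U \<longleftrightarrow> U \<noteq> {} \<and>
     (\<forall>A. A \<subseteq> U \<longrightarrow> A \<noteq> {} \<longrightarrow> A \<noteq> U \<longrightarrow> (\<exists>x\<in>A. \<exists>y\<in>U - A. (x, y) \<in> E))"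

lemma connD:
  assumes "conn E U" "A \<subseteq> U" "A \<noteq> {}" "A \<noteq> U"
  obtains x y where "x \<in> A" "y \<in> U - A" "(x, y) \<in> E"
  using assms unfolding conn_def by blast

lemma conn_singleton: "conn E {x}"
  unfolding conn_def by blast

text \<open>A part of the union that cut neither \<open>A\<close> nor \<open>B\<close> would contain
  all or nothing of each. The common point \<open>z\<close> makes the two choices agree, so a proper
  part cuts one of them, and that cut supplies the edge.\<close>

lemma conn_Un:
  assumes "conn E A" "conn E B" "z \<in> A" "z \<in> B"
  shows "conn E (A \<union> B)"
  unfolding conn_def
proof (intro conjI allI impI)
  show "A \<union> B \<noteq> {}" using assms by blast
  fix C assume C: "C \<subseteq> A \<union> B" "C \<noteq> {}" "C \<noteq> A \<union> B"
  consider "C \<inter> A \<noteq> {}" "C \<inter> A \<noteq> A" | "C \<inter> B \<noteq> {}" "C \<inter> B \<noteq> B"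
    using C assms(3,4) by blast
  then show "\<exists>x\<in>C. \<exists>y\<in>A \<union> B - C. (x, y) \<in> E"
  proof cases
    case 1
    then obtain x y where "x \<in> C \<inter> A" "y \<in> A - C \<inter> A" "(x, y) \<in> E"
      using connD[OF assms(1), of "C \<inter> A"] by (metis inf_le2)
    then show ?thesis by blast
  next
    case 2
    then obtain x y where "x \<in> C \<inter> B" "y \<in> B - C \<inter> B" "(x, y) \<in> E"
      using connD[OF assms(2), of "C \<inter> B"] by (metis inf_le2)
    then show ?thesis by blast
  qed
qed

lemma conn_edge:
  assumes "sym E" "(x, y) \<in> E"
  shows "conn E {x, y}"
  unfolding conn_def
proof (intro conjI allI impI)
  fix A assume "A \<subseteq> {x, y}" "A \<noteq> {}" "A \<noteq> {x, y}"
  then have "A = {x} \<and> x \<noteq> y \<or> A = {y} \<and> x \<noteq> y" by blast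
  then show "\<exists>x'\<in>A. \<exists>y'\<in>{x, y} - A. (x', y') \<in> E"
    using assms symD[OF assms] by auto
qed simp

lemma conn_insert:
  assumes "sym E" "conn E A" "x \<in> A" "(x, y) \<in> E"
  shows "conn E (insert y A)"
proof -
  have "conn E (A \<union> {x, y})"
    by (rule conn_Un[OF assms(2) conn_edge[OF assms(1,4)] assms(3)]) simp
  moreover have "A \<union> {x, y} = insert y A" using assms(3) by blast
  ultimately show ?thesis by simp
qed

lemma conn_mono: "conn E U \<Longrightarrow> E \<subseteq> F \<Longrightarrow> conn F U"
  unfolding conn_def by blast

text \<open>This grows a spanning tree from \<open>w\<close>, one vertex along one edge at a time.
  Tours, edge counts and spanning trees below are all obtained from it.\<close>

lemma conn_induct [consumes 3, case_names singleton insert]: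
  assumes "finite U" "conn E U" "w \<in> U"
    and base: "P {w}"
    and step: "\<And>A x y. A \<subseteq> U \<Longrightarrow> w \<in> A \<Longrightarrow> P A \<Longrightarrow> x \<in> A \<Longrightarrow> y \<in> U - A \<Longrightarrow>
      (x, y) \<in> E \<Longrightarrow> P (insert y A)"
  shows "P U"
proof -
  have grow: "P A \<Longrightarrow> A \<subseteq> U \<Longrightarrow> w \<in> A \<Longrightarrow> P U" for A
  proof (induction "card (U - A)" arbitrary: A rule: less_induct)
    case less
    show ?case
    proof (cases "A = U")
      case True
      then show ?thesis using less by simp
    next
      case False
      then obtain x y where xy: "x \<in> A" "y \<in> U - A" "(x, y) \<in> E"
        using less.prems connD[OF assms(2), of A] by blast
      have "U - insert y A \<subset> U - A" using xy by blast
      then have "card (U - insert y A) < card (U - A)"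
        using assms(1) by (intro psubset_card_mono) auto
      then show ?thesis
        using less.hyps[of "insert y A"] step[OF less.prems(2,3,1) xy] less.prems xy by blast
    qed
  qed
  show ?thesis using grow[OF base] assms(3) by blast
qed

text \<open>The rest of \<open>U\<close> is attached to \<open>D\<close> only at \<open>v\<close>.
  Of the two sides of a cut of \<open>D\<close>, the one without \<open>v\<close> is also a side of
  a cut of \<open>U\<close>, and the edge leaving it stays in \<open>D\<close>.\<close>

lemma conn_lobe:
  assumes "sym E" "conn E U" "v \<in> D" "D \<subseteq> U"
    and "\<And>x y. x \<in> D - {v} \<Longrightarrow> y \<in> U - D \<Longrightarrow> (x, y) \<notin> E"
  shows "conn E D"
  unfolding conn_def
proof (intro conjI allI impI)
  show "D \<noteq> {}" using assms(3) by blast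
  fix A assume A: "A \<subseteq> D" "A \<noteq> {}" "A \<noteq> D"
  show "\<exists>x\<in>A. \<exists>y\<in>D - A. (x, y) \<in> E"
  proof (cases "v \<in> A")
    case False
    then have "A \<subseteq> U" "A \<noteq> U" using A assms(3,4) by auto
    then obtain x y where xy: "x \<in> A" "y \<in> U - A" "(x, y) \<in> E"
      using connD[OF assms(2), of A] A(2) by metis
    then have "y \<in> D" using assms(5)[of x y] A(1) False by auto
    then show ?thesis using xy by auto
  next
    case True
    then have "D - A \<subseteq> U" "D - A \<noteq> {}" "D - A \<noteq> U" using A assms(3,4) by auto
    then obtain x y where xy: "x \<in> D - A" "y \<in> U - (D - A)" "(x, y) \<in> E"
      using connD[OF assms(2), of "D - A"] by metis
    then have "y \<in> A" using assms(5)[of x y] True by auto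
    then show ?thesis using xy symD[OF assms(1), of x y] by auto
  qed
qed

section \<open>Walks as vertex lists\<close>

definition walk :: "'a rel \<Rightarrow> 'a \<Rightarrow> 'a list \<Rightarrow> 'a \<Rightarrow> bool" where
  "walk E x xs y \<longleftrightarrow>
     xs \<noteq> [] \<and> hd xs = x \<and> last xs = y \<and> successively (\<lambda>a b. (a, b) \<in> E) xs"

lemma walk_singleton: "walk E x [x] x"
  by (simp add: walk_def)

lemma walk_Cons: "(x, y) \<in> E \<Longrightarrow> walk E y ys z \<Longrightarrow> walk E x (x # ys) z"
  by (cases ys) (auto simp: walk_def)

lemma walk_split:
  assumes "walk E x (as @ y # bs) z"
  shows "walk E x (as @ [y]) y" "walk E y (y # bs) z"
  using assms by (auto simp: walk_def successively_append_iff hd_append split: if_splits)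

lemma walk_join:
  assumes "walk E x (as @ [y]) y" "walk E y (y # bs) z"
  shows "walk E x (as @ y # bs) z"
  using assms by (auto simp: walk_def successively_append_iff hd_append split: if_splits)

lemma conn_walk:
  assumes "sym E" "walk E x xs y"
  shows "conn E (set xs)"
proof -
  have "xs \<noteq> []" "successively (\<lambda>a b. (a, b) \<in> E) xs"
    using assms(2) by (auto simp: walk_def)
  then show ?thesis
  proof (induction xs)
    case (Cons a xs)
    show ?case
    proof (cases xs)
      case Nil
      then show ?thesis by (simp add: conn_singleton)
    next
      case (Cons b ys)
      then have "conn E (set xs)" "(b, a) \<in> E" "b \<in> set xs"
        using Cons.IH Cons.prems symD[OF assms(1)] by auto
      then show ?thesis using conn_insert[OF assms(1)] by fastforce
    qed
  qed simp
qed

section \<open>Closed tours and lower bounds on connected sets\<close>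

text \<open>Walking around a spanning tree traverses every edge twice.\<close>

lemma closed_tour:
  assumes "sym E" "finite U" "conn E U" "w \<in> U"
  obtains xs where "walk E w xs w" "set xs = U" "length xs + 1 \<le> 2 * card U"
proof -
  have "\<exists>xs. walk E w xs w \<and> set xs = U \<and> length xs + 1 \<le> 2 * card U"
    using assms(2-4)
  proof (induction rule: conn_induct)
    case singleton
    show ?case using walk_singleton[of E w] by (intro exI[of _ "[w]"]) auto
  next
    case (insert A x y)
    then obtain xs where xs: "walk E w xs w" "set xs = A" "length xs + 1 \<le> 2 * card A"
      by blast
    then obtain as bs where ab: "xs = as @ x # bs"
      using insert by (meson split_list)
    have "(y, x) \<in> E" using insert assms(1) by (meson symD)
    \<comment> \<open>A detour to the new leaf \<open>y\<close> and back, made at an occurrence of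
      \<open>x\<close>, lengthens the list by two.\<close>
    then have "walk E w (as @ x # y # x # bs) w"
      using xs(1) insert walk_split[of E w as x bs w] walk_join[of E w as x "y # x # bs" w]
      unfolding ab by (auto intro: walk_Cons)
    moreover have "card (insert y A) = Suc (card A)"
      using insert assms(2) finite_subset by (subst card_insert_disjoint) auto
    moreover have "set (as @ x # y # x # bs) = insert y A"
      using xs(2) unfolding ab by auto
    ultimately show ?case
      using xs(3) unfolding ab by (intro exI[of _ "as @ x # y # x # bs"]) auto
  qed
  then show ?thesis using that by blast
qed

text \<open>
  The distance from \<open>x\<close> to \<open>y\<close> inside \<open>V\<close> is at least \<open>n\<close>: walks are vertex lists, one
  longer than their number of edges.
\<close>

definition far :: "'a rel \<Rightarrow> 'a set \<Rightarrow> nat \<Rightarrow> 'a \<Rightarrow> 'a \<Rightarrow> bool" where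
  "far E V n x y \<longleftrightarrow> (\<forall>xs. walk E x xs y \<longrightarrow> set xs \<subseteq> V \<longrightarrow> n < length xs)"

lemma farD: "far E V n x y \<Longrightarrow> walk E x xs y \<Longrightarrow> set xs \<subseteq> V \<Longrightarrow> n < length xs"
  unfolding far_def by blast

text \<open>The walk is cut at its first point of \<open>Y\<close>. The piece before it has at least
  \<open>c\<close> edges, and the rest is a walk of the same kind, with \<open>a\<close> in the role
  of \<open>c\<close>; this is why the first leg has a constant of its own.\<close>

lemma walk_visiting_length:
  assumes "walk E u xs w" "set xs \<subseteq> V" "Y \<subseteq> set xs" "Y \<noteq> {}"
    and "\<And>y. y \<in> Y \<Longrightarrow> far E V c u y"
    and "\<And>y z. y \<in> Y \<Longrightarrow> z \<in> Y \<Longrightarrow> y \<noteq> z \<Longrightarrow> far E V a y z"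
    and "\<And>y. y \<in> Y \<Longrightarrow> far E V b y w"
  shows "c + (card Y - 1) * a + b < length xs"
  using assms
proof (induction "card Y" arbitrary: u xs Y c rule: less_induct)
  case less
  have fin: "finite Y" by (rule finite_subset[OF less.prems(3) List.finite_set])
  have "\<exists>x\<in>set xs. x \<in> Y" using less.prems(3,4) by blast
  then obtain as y bs where xs: "xs = as @ y # bs" "y \<in> Y" "\<forall>x\<in>set as. x \<notin> Y"
    by (rule split_list_first_propE)
  note w = walk_split[OF less.prems(1)[unfolded xs(1)]]
  have c: "c < length (as @ [y])"
    using less.prems(2) unfolding xs(1) by (intro farD[OF less.prems(5)[OF xs(2)] w(1)]) simp
  show ?case
  proof (cases "Y = {y}")
    case True
    have "b < length (y # bs)"
      using less.prems(2) unfolding xs(1) by (intro farD[OF less.prems(7)[OF xs(2)] w(2)]) simp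
    then show ?thesis using c True xs(1) by simp
  next
    case False
    have cd: "card (Y - {y}) = card Y - 1" "card (Y - {y}) < card Y"
      using card_Diff1_less[OF fin xs(2)] xs(2) by auto
    have ne: "Y - {y} \<noteq> {}" using False xs(2) by blast
    have "a + (card (Y - {y}) - 1) * a + b < length (y # bs)"
    proof (rule less.hyps[OF cd(2) w(2)])
      \<comment> \<open>The remaining walk still meets all of \<open>Y\<close> because
        \<open>y\<close> was the first point of \<open>Y\<close> on it.\<close>
      show "Y - {y} \<subseteq> set (y # bs)" using less.prems(3) xs by auto
      show "set (y # bs) \<subseteq> V" using less.prems(2) xs by auto
      show "Y - {y} \<noteq> {}" by (rule ne)
      show "far E V a y z" if "z \<in> Y - {y}" for z
        using that xs(2) by (intro less.prems(6)) auto
      show "far E V a x z" if "x \<in> Y - {y}" "z \<in> Y - {y}" "x \<noteq> z" for x z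
        using that by (intro less.prems(6)) auto
      show "far E V b x w" if "x \<in> Y - {y}" for x
        using that by (intro less.prems(7)) auto
    qed
    moreover have "0 < card (Y - {y})" using ne fin by (simp add: card_gt_0_iff)
    then obtain j where "card Y = Suc (Suc j)"
      using cd(1) less_imp_Suc_add[of 1 "card Y"] by auto
    ultimately show ?thesis using c cd(1) by (simp add: xs(1))
  qed
qed

text \<open>A closed tour of \<open>U\<close> from \<open>w\<close> has at most
  \<open>2 * (card U - 1)\<close> edges. It pays \<open>b\<close> to reach \<open>Y\<close>,
  \<open>a\<close> for each of the \<open>card Y - 1\<close> legs inside \<open>Y\<close>, and
  \<open>b\<close> to return.\<close>

lemma conn_card_lower_bound:
  assumes "sym E" "finite U" "conn E U" "w \<in> U" "U \<subseteq> V" "Y \<subseteq> U" "Y \<noteq> {}"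
    and "\<And>y. y \<in> Y \<Longrightarrow> far E V b w y"
    and "\<And>y z. y \<in> Y \<Longrightarrow> z \<in> Y \<Longrightarrow> y \<noteq> z \<Longrightarrow> far E V a y z"
    and "\<And>y. y \<in> Y \<Longrightarrow> far E V b y w"
  shows "2 * b + (card Y - 1) * a + 2 \<le> 2 * card U"
proof -
  obtain xs where xs: "walk E w xs w" "set xs = U" "length xs + 1 \<le> 2 * card U"
    using closed_tour[OF assms(1-4)] .
  have "b + (card Y - 1) * a + b < length xs"
    by (rule walk_visiting_length[OF xs(1)]) (use xs(2) assms(5-10) in simp_all)
  then show ?thesis using xs(3) by simp
qed

section \<open>Splitting a connected set at a branch point\<close>

text \<open>
  In a tree the walk \<open>p\<close> leads from \<open>v\<close> to the place where the paths from \<open>v\<close> to the points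
  of \<open>X\<close> part, or to a point of \<open>X\<close> if that comes first.
\<close>

lemma branching_decomposition:
  assumes "sym E" "finite U" "conn E U" "v \<in> U" "X \<subseteq> U" "X \<noteq> {}"
  shows "\<exists>w p A B. walk E v p w \<and> set p \<subseteq> U \<and> conn E A \<and> conn E B \<and> A \<subseteq> U \<and> B \<subseteq> U \<and>
    w \<in> A \<and> w \<in> B \<and> X \<subseteq> A \<union> B \<and> card A + card B + length p \<le> card U + 2 \<and>
    (w \<in> X \<or> w \<notin> X \<and> X \<inter> A \<inter> B = {} \<and> X \<inter> A \<noteq> {} \<and> X \<inter> B \<noteq> {})"
  using assms(2-6)
proof (induction "card U" arbitrary: U v rule: less_induct)
  case less
  note IH = less.hyps
  have fin: "finite U" and cU: "conn E U" and vU: "v \<in> U" and XU: "X \<subseteq> U" by fact+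
  show ?case
  proof (cases "v \<in> X")
    case True
    \<comment> \<open>The path is trivial and \<open>A\<close> is all of \<open>U\<close>;
      \<open>B = {v}\<close> and \<open>p = [v]\<close> give exactly
      \<open>card U + 2\<close>.\<close>
    then show ?thesis
      using less.prems walk_singleton[of E v] conn_singleton[of E v]
      by (intro exI[of _ v] exI[of _ "[v]"] exI[of _ U] exI[of _ "{v}"]) auto
  next
    case vX: False
    let ?W = "U - {v}"
    have W: "?W \<noteq> {}" using vX XU less.prems(5) by blast
    have cW: "card ?W < card U" "Suc (card ?W) = card U"
      using card_Diff1_less[OF fin vU] card_Suc_Diff1[OF fin vU] by auto
    show ?thesis
    \<comment> \<open>\<open>U\<close> need not induce a tree, so the recursion asks whether
      \<open>v\<close> is a cut vertex. If not, \<open>p\<close> starts with a step to a neighbour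
      \<open>v'\<close>, and the vertex gained by \<open>p\<close> is the one lost from
      \<open>U\<close>.\<close>
    proof (cases "conn E ?W")
      case True
      obtain v' where v': "v' \<in> ?W" "(v, v') \<in> E"
        using connD[OF cU, of "{v}"] vU W by blast
      have "X \<subseteq> ?W" using vX XU by blast
      from IH[OF cW(1) finite_Diff[OF fin] True v'(1) this less.prems(5)]
      obtain w p A B where IH': "walk E v' p w" "set p \<subseteq> ?W" "conn E A" "conn E B"
        "A \<subseteq> ?W" "B \<subseteq> ?W" "w \<in> A" "w \<in> B" "X \<subseteq> A \<union> B"
        "card A + card B + length p \<le> card ?W + 2"
        "w \<in> X \<or> w \<notin> X \<and> X \<inter> A \<inter> B = {} \<and> X \<inter> A \<noteq> {} \<and> X \<inter> B \<noteq> {}"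
        by (elim exE conjE) (rule that)
      have "walk E v (v # p) w" using v'(2) IH'(1) by (rule walk_Cons)
      moreover have "card A + card B + length (v # p) \<le> card U + 2"
        using IH'(10) cW(2) by simp
      moreover have "set (v # p) \<subseteq> U" "A \<subseteq> U" "B \<subseteq> U" using IH' vU by auto
      ultimately show ?thesis
        using IH' by (intro exI[of _ w] exI[of _ "v # p"] exI[of _ A] exI[of _ B] conjI)
    next
      case False
      \<comment> \<open>Here \<open>v\<close> is a cut vertex: no edge joins \<open>C\<close> to the
        rest of \<open>U - {v}\<close>, so \<open>insert v C\<close> and \<open>U - C\<close> are
        connected lobes that meet only in \<open>v\<close>.\<close>
      then obtain C where C: "C \<subseteq> ?W" "C \<noteq> {}" "C \<noteq> ?W"
        "\<And>x y. x \<in> C \<Longrightarrow> y \<in> ?W - C \<Longrightarrow> (x, y) \<notin> E"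
        using W unfolding conn_def by blast
      let ?A = "insert v C" and ?B = "U - C"
      have cA: "conn E ?A"
        using C vU by (intro conn_lobe[OF assms(1) cU, of v]) auto
      have cB: "conn E ?B"
        using C vU assms(1) by (intro conn_lobe[OF assms(1) cU, of v]) (auto dest: symD)
      have cdC: "card C + card ?B = card U"
        using C(1) fin by (metis card_Diff_subset card_mono finite_subset le_add_diff_inverse
            Diff_subset subset_trans)
      have "finite C" using C(1) fin finite_subset by blast
      then have cdA: "card ?A = Suc (card C)"
        using C(1) by (subst card_insert_disjoint) auto
      have sub: "?A \<subset> U" "?B \<subset> U" using C vU by auto
      have lt: "card ?A < card U" "card ?B < card U"
        using sub fin psubset_card_mono by blast+
      \<comment> \<open>If one lobe contains \<open>X\<close>, the other is discarded and the
        recursion continues from the same \<open>v\<close>.\<close>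
      have lift: ?thesis if "D \<subset> U" "conn E D" "v \<in> D" "X \<subseteq> D" for D
      proof -
        have D: "card D < card U" "finite D"
          using that(1) fin by (auto intro: psubset_card_mono finite_subset)
        from IH[OF D that(2-4) less.prems(5)] obtain w p A B where
          IH': "walk E v p w" "set p \<subseteq> D" "conn E A" "conn E B"
          "A \<subseteq> D" "B \<subseteq> D" "w \<in> A" "w \<in> B" "X \<subseteq> A \<union> B"
          "card A + card B + length p \<le> card D + 2"
          "w \<in> X \<or> w \<notin> X \<and> X \<inter> A \<inter> B = {} \<and> X \<inter> A \<noteq> {} \<and> X \<inter> B \<noteq> {}"
          by (elim exE conjE) (rule that)
        moreover have "card A + card B + length p \<le> card U + 2" using IH'(10) D(1) by simp
        moreover have "set p \<subseteq> U" "A \<subseteq> U" "B \<subseteq> U" using IH' that(1) by auto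
        ultimately show ?thesis
          by (intro exI[of _ w] exI[of _ p] exI[of _ A] exI[of _ B] conjI)
      qed
      consider "X \<subseteq> ?A" | "X \<subseteq> ?B" | "X \<inter> ?A \<noteq> {}" "X \<inter> ?B \<noteq> {}"
        using XU by blast
      then show ?thesis
      proof cases
        case 1
        then show ?thesis using lift[OF sub(1) cA] by simp
      next
        case 2
        moreover have "v \<in> ?B" using vU C(1) by blast
        ultimately show ?thesis using lift[OF sub(2) cB] by simp
      next
        \<comment> \<open>\<open>X\<close> meets both lobes, so \<open>v\<close> is the branch
          point. The lobes count \<open>v\<close> twice and \<open>p = [v]\<close> adds one, which
          again gives \<open>card U + 2\<close>.\<close>
        case 3
        then show ?thesis
          using cA cB cdC cdA vX vU XU C(1) walk_singleton[of E v]
          by (intro exI[of _ v] exI[of _ "[v]"] exI[of _ ?A] exI[of _ ?B]) auto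
      qed
    qed
  qed
qed

section \<open>From subgraphs to connected vertex sets\<close>

text \<open>Each vertex \<open>y\<close> added while growing \<open>U\<close> brings an edge
  \<open>{x, y}\<close> that is new because \<open>y\<close> is.\<close>

lemma conn_card_le_edges:
  assumes "finite U" "conn E U" "finite E"
  shows "card U \<le> Suc (card ((\<lambda>(u, v). {u, v}) ` E))"
proof -
  obtain w where "w \<in> U" using assms(2) unfolding conn_def by blast
  let ?f = "\<lambda>(u, v). {u, v}"
  have "card U \<le> Suc (card (?f ` (E \<inter> U \<times> U)))"
    using assms(1,2) \<open>w \<in> U\<close>
  proof (induction rule: conn_induct)
    case (insert A x y)
    have fin: "finite (?f ` (E \<inter> B))" for B using assms(3) by blast
    have "{x, y} \<notin> ?f ` (E \<inter> A \<times> A)" using insert by auto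
    then have "Suc (card (?f ` (E \<inter> A \<times> A))) = card (insert {x, y} (?f ` (E \<inter> A \<times> A)))"
      using fin by simp
    also have "\<dots> \<le> card (?f ` (E \<inter> insert y A \<times> insert y A))"
      using insert by (intro card_mono fin) force
    finally show ?case
      using insert card_insert_le_m1 card_insert_if[of A y] assms(1) finite_subset[of A U] by auto
  qed simp
  also have "\<dots> \<le> Suc (card (?f ` E))"
    using assms(3) by (auto intro!: card_mono)
  finally show ?thesis .
qed

text \<open>Only the edge along which a vertex is added is kept, in both directions. The bound on
  the number of edges stands for acyclicity.\<close>

lemma spanning_tree:
  assumes "sym E" "finite U" "conn E U"
  obtains T where "T \<subseteq> E" "T \<subseteq> U \<times> U" "sym T" "conn T U"
    "card ((\<lambda>(u, v). {u, v}) ` T) \<le> card U - 1"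
proof -
  obtain w where "w \<in> U" using assms(3) unfolding conn_def by blast
  let ?f = "\<lambda>(u, v). {u, v}"
  have "\<exists>T. T \<subseteq> E \<and> T \<subseteq> U \<times> U \<and> sym T \<and> conn T U \<and> card (?f ` T) \<le> card U - 1"
    using assms(2,3) \<open>w \<in> U\<close>
  proof (induction rule: conn_induct)
    case singleton
    then show ?case
      by (intro exI[of _ "{}"]) (auto simp: sym_def conn_singleton)
  next
    case (insert A x y)
    then obtain T where T: "T \<subseteq> E" "T \<subseteq> A \<times> A" "sym T" "conn T A"
      "card (?f ` T) \<le> card A - 1" by blast
    have fA: "finite A" using insert assms(2) finite_subset by blast
    have fT: "finite (?f ` T)" using T(2) fA finite_subset[of T "A \<times> A"] by blast
    let ?T = "T \<union> {(x, y), (y, x)}"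
    have s: "sym ?T" using T(3) by (auto simp: sym_def)
    have "(y, x) \<in> E" using insert assms(1) by (meson symD)
    moreover have "conn ?T A" using T(4) by (rule conn_mono) blast
    then have "conn ?T (insert y A)"
      using s \<open>x \<in> A\<close> by (intro conn_insert[of ?T A x y]) auto
    moreover have "?f ` ?T = insert {x, y} (?f ` T)" by auto
    then have "card (?f ` ?T) \<le> Suc (card (?f ` T))"
      using fT by (simp add: card_insert_if)
    moreover have "card A > 0" using insert fA card_gt_0_iff by blast
    moreover have "card (insert y A) = Suc (card A)" using insert fA by simp
    moreover have "?T \<subseteq> insert y A \<times> insert y A" using T(2) \<open>x \<in> A\<close> by blast
    ultimately show ?case using T(1,5) s \<open>(x, y) \<in> E\<close> by (intro exI[of _ ?T] conjI) simp_all
  qed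
  then show ?thesis using that by blast
qed

lemma connected_iff_conn:
  assumes "pair_graph H"
  shows "Digraph_Component.connected (with_proj H) \<longleftrightarrow> conn (parcs H) (pverts H)"
proof -
  interpret pair_graph H by fact
  let ?R = "\<lambda>u v. (u, v) \<in> rtrancl_on (pverts H) (parcs H)"
  \<comment> \<open>The arcs are symmetric already, so connectedness of \<open>H\<close> is mutual
    reachability in \<open>H\<close> itself.\<close>
  have "parcs (mk_symmetric (with_proj H)) = parcs H"
    using adj_mk_symmetric_eq[OF pair_sym_arcs] by simp
  then have eq: "Digraph_Component.connected (with_proj H) \<longleftrightarrow>
      pverts H \<noteq> {} \<and> (\<forall>u\<in>pverts H. \<forall>v\<in>pverts H. ?R u v)"
    by (simp add: connected_def strongly_connected_def reachable_def)
  show ?thesis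
    unfolding eq
  proof
    assume L: "pverts H \<noteq> {} \<and> (\<forall>u\<in>pverts H. \<forall>v\<in>pverts H. ?R u v)"
    show "conn (parcs H) (pverts H)"
      unfolding conn_def
    proof (intro conjI allI impI)
      fix A assume A: "A \<subseteq> pverts H" "A \<noteq> {}" "A \<noteq> pverts H"
      then obtain u v where uv: "u \<in> A" "v \<in> pverts H - A" by blast
      show "\<exists>x\<in>A. \<exists>y\<in>pverts H - A. (x, y) \<in> parcs H"
      proof (rule ccontr)
        assume no: "\<not> ?thesis"
        have "?R u v" using L uv A(1) by auto
        then have "v \<in> A"
        proof (induction rule: rtrancl_on_induct)
          case (step y z)
          then show ?case using no by auto
        qed (use uv in simp)
        then show False using uv by simp
      qed
    qed (use L in simp)
  next
    assume R: "conn (parcs H) (pverts H)"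
    have "?R u v" if "u \<in> pverts H" "v \<in> pverts H" for u v
    proof (rule ccontr)
      assume no: "\<not> ?R u v"
      \<comment> \<open>No arc leaves the set of vertices reachable from \<open>u\<close>, so it
        would be a cut without a crossing edge.\<close>
      let ?A = "{x \<in> pverts H. ?R u x}"
      have "u \<in> ?A" "v \<notin> ?A" using that no by auto
      then have "?A \<subseteq> pverts H" "?A \<noteq> {}" "?A \<noteq> pverts H" using that(2) by auto
      then obtain x y where xy: "x \<in> ?A" "y \<in> pverts H - ?A" "(x, y) \<in> parcs H"
        by (rule connD[OF R])
      then have "?R u y" using rtrancl_on_into_rtrancl_on[of u x "pverts H" "parcs H" y] by simp
      then show False using xy(2) by simp
    qed
    then show "pverts H \<noteq> {} \<and> (\<forall>u\<in>pverts H. \<forall>v\<in>pverts H. ?R u v)"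
      using R unfolding conn_def by simp
  qed
qed

text \<open>Together with \<open>steiner_dist_conn\<close>, this makes
  \<open>steiner_dist G S + 1\<close> the least cardinality of a connected vertex set containing
  \<open>S\<close>, for connected \<open>G\<close>. A spanning tree of \<open>U\<close> is the
  subgraph that witnesses this half.\<close>

lemma steiner_dist_le_conn:
  assumes "pair_graph G" "conn (parcs G) U" "U \<subseteq> pverts G" "S \<subseteq> U"
  shows "steiner_dist G S \<le> card U - 1"
proof -
  interpret pair_graph G by fact
  have fin: "finite U" by (rule finite_subset[OF assms(3) pair_finite_verts])
  have sym: "sym (parcs G)" by (rule symI) (rule arcs_symmetric)
  obtain T where T: "T \<subseteq> parcs G" "T \<subseteq> U \<times> U" "sym T" "conn T U"
    "card ((\<lambda>(u, v). {u, v}) ` T) \<le> card U - 1"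
    using spanning_tree[OF sym fin assms(2)] .
  let ?H = "\<lparr>pverts = U, parcs = T\<rparr>"
  have finT: "finite T" using T(2) fin finite_subset by blast
  have H: "pair_graph ?H"
    using T fin finT no_loops' by unfold_locales (auto simp: symmetric_def)
  have "wf_digraph (with_proj ?H)"
    using T(2) by unfold_locales auto
  then have "?H \<in> connected_subgraphs_containing G S"
    using H T assms wf_digraph connected_iff_conn[OF H]
    by (auto simp: connected_subgraphs_containing_def subgraph_def compatible_def)
  then have "steiner_dist G S \<le> graph_size ?H"
    unfolding steiner_dist_def
    using finite_connected_subgraphs_containing[OF assms(1)] by (intro Min_le) auto
  then show ?thesis using T(5) by (simp add: graph_size_def)
qed

lemma steiner_dist_conn:
  assumes "pair_graph G" "Digraph_Component.connected (with_proj G)" "S \<subseteq> pverts G"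
  obtains U where "conn (parcs G) U" "U \<subseteq> pverts G" "S \<subseteq> U" "card U \<le> Suc (steiner_dist G S)"
proof -
  interpret pair_graph G by fact
  have "steiner_dist G S \<in> graph_size ` connected_subgraphs_containing G S"
    unfolding steiner_dist_def
    using finite_connected_subgraphs_containing[OF assms(1)]
      connected_subgraphs_containing_nonempty[OF assms] by (intro Min_in) auto
  then obtain H where H: "H \<in> connected_subgraphs_containing G S" "steiner_dist G S = graph_size H"
    by blast
  then have sub: "pair_graph H" "pverts H \<subseteq> pverts G" "parcs H \<subseteq> parcs G" "S \<subseteq> pverts H"
    "conn (parcs H) (pverts H)"
    using connected_iff_conn by (auto simp: connected_subgraphs_containing_def subgraph_def)
  have "card (pverts H) \<le> Suc (steiner_dist G S)"
    using conn_card_le_edges[OF _ sub(5)] sub(2,3) H(2) pair_finite_verts pair_finite_arcs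
    by (simp add: graph_size_def finite_subset)
  then show ?thesis using that[OF conn_mono[OF sub(5,3)] sub(2,4)] by blast
qed

text \<open>The walk adds at most \<open>length xs - 1\<close> vertices to \<open>U\<close>, since
  \<open>x\<close> is shared. Read backwards, a large Steiner distance forces the walk to be long;
  the distance bounds below come from this.\<close>

lemma steiner_dist_le_walk:
  assumes "pair_graph G" "conn (parcs G) U" "U \<subseteq> pverts G"
    and "walk (parcs G) x xs y" "set xs \<subseteq> pverts G" "S \<subseteq> insert y U" "x \<in> U"
  shows "steiner_dist G S + 2 \<le> card U + length xs"
proof -
  interpret pair_graph G by fact
  have fin: "finite U" by (rule finite_subset[OF assms(3) pair_finite_verts])
  have sym: "sym (parcs G)" by (rule symI) (rule arcs_symmetric)
  have xy: "x \<in> set xs" "y \<in> set xs" using assms(4) by (auto simp: walk_def)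
  have "conn (parcs G) (U \<union> set xs)"
    by (rule conn_Un[OF assms(2) conn_walk[OF sym assms(4)] assms(7) xy(1)])
  then have "steiner_dist G S \<le> card (U \<union> set xs) - 1"
    using assms xy by (intro steiner_dist_le_conn) auto
  moreover have "card (U \<union> set xs) + card (U \<inter> set xs) = card U + card (set xs)"
    using fin card_Un_Int by (metis List.finite_set)
  moreover have "card (U \<inter> set xs) > 0" "card (U \<union> set xs) > 0"
    using fin assms(7) xy(1) by (auto simp: card_gt_0_iff)
  moreover have "card (set xs) \<le> length xs" by (rule card_length)
  ultimately show ?thesis by linarith
qed

section \<open>The excess of a Steiner distance over the radius\<close>

lemma far_sym:
  assumes "sym E" "far E V n x y"
  shows "far E V n y x"
  unfolding far_def
proof (intro allI impI)
  fix xs assume xs: "walk E y xs x" "set xs \<subseteq> V"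
  then have "successively (\<lambda>a b. (a, b) \<in> E) xs" by (simp add: walk_def)
  then have "successively (\<lambda>a b. (b, a) \<in> E) xs"
    by (rule successively_mono) (rule symD[OF assms(1)])
  then have "walk E x (rev xs) y"
    using xs(1) by (auto simp: walk_def hd_rev last_rev)
  then show "n < length xs" using farD[OF assms(2), of "rev xs"] xs(2) by simp
qed

lemma steiner_dist_excess:
  assumes "pair_graph G" "Digraph_Component.connected (with_proj G)"
    and k: "5 \<le> card S" and S: "S \<subseteq> pverts G" and v: "v \<in> pverts G"
    and r: "\<And>s. s \<in> S \<Longrightarrow> steiner_dist G (insert v (S - {s})) \<le> r"
    and d: "steiner_dist G S = r + d"
  shows "(card S + 1) * d \<le> 2 * r"
proof -
  interpret pair_graph G by fact
  let ?E = "parcs G" and ?V = "pverts G"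
  have sym: "sym ?E" by (rule symI) (rule arcs_symmetric)
  have finS: "finite S" by (rule finite_subset[OF S pair_finite_verts])
  have "S \<noteq> {}" using k by auto
  define m where "m = Max ((\<lambda>s. steiner_dist G (S - {s})) ` S)"
  have m_ge: "steiner_dist G (S - {s}) \<le> m" if "s \<in> S" for s
    unfolding m_def using that finS by auto
  have "m \<in> (\<lambda>s. steiner_dist G (S - {s})) ` S"
    unfolding m_def using finS \<open>S \<noteq> {}\<close> by (intro Max_in) auto
  \<comment> \<open>As \<open>s\<close> attains the maximum, every connected set containing
    \<open>S - {s}\<close> has more than \<open>m\<close> vertices; this later bounds
    \<open>q\<close>.\<close>
  then obtain s where s: "s \<in> S" "steiner_dist G (S - {s}) = m" by auto
  let ?X = "S - {s}"
  have cX: "card ?X = card S - 1" using s(1) finS by simp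
  obtain U where U: "conn ?E U" "U \<subseteq> ?V" "insert v ?X \<subseteq> U" "card U \<le> Suc r"
  proof (rule steiner_dist_conn[OF assms(1,2), of "insert v ?X"])
    show "insert v ?X \<subseteq> ?V" using S v by blast
  next
    fix U assume "conn ?E U" "U \<subseteq> ?V" "insert v ?X \<subseteq> U"
      "card U \<le> Suc (steiner_dist G (insert v ?X))"
    then show thesis using r[OF s(1)] by (intro that) auto
  qed
  have finU: "finite U" by (rule finite_subset[OF U(2) pair_finite_verts])
  have "m \<le> r"
    using steiner_dist_le_conn[OF assms(1) U(1,2), of ?X] U(3,4) s(2) by auto
  define l where "l = r - m"
  \<comment> \<open>A connected set for \<open>S - {y}\<close> with at most \<open>m + 1\<close>
    vertices contains \<open>x\<close>. Prolonging it to \<open>y\<close> reaches all of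
    \<open>S\<close>, so the walk has at least \<open>r + d - m = d + l\<close> edges.\<close>
  have dSS: "far ?E ?V (d + l) x y" if "x \<in> S" "y \<in> S" "x \<noteq> y" for x y
    unfolding far_def
  proof (intro allI impI)
    fix xs assume xs: "walk ?E x xs y" "set xs \<subseteq> ?V"
    obtain W where W: "conn ?E W" "W \<subseteq> ?V" "S - {y} \<subseteq> W" "card W \<le> Suc (steiner_dist G (S - {y}))"
      using steiner_dist_conn[OF assms(1,2), of "S - {y}"] S by blast
    have "steiner_dist G S + 2 \<le> card W + length xs"
      using that W(3) by (intro steiner_dist_le_walk[OF assms(1) W(1,2) xs]) auto
    then show "d + l < length xs" using W(4) m_ge[OF that(2)] \<open>m \<le> r\<close> d unfolding l_def by linarith
  qed
  \<comment> \<open>The same argument from \<open>v\<close>: the connected set may now have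
    \<open>r + 1\<close> vertices, so the gain \<open>l\<close> is lost.\<close>
  have dvS: "far ?E ?V d v y" if "y \<in> S" for y
    unfolding far_def
  proof (intro allI impI)
    fix xs assume xs: "walk ?E v xs y" "set xs \<subseteq> ?V"
    obtain W where W: "conn ?E W" "W \<subseteq> ?V" "insert v (S - {y}) \<subseteq> W"
      "card W \<le> Suc (steiner_dist G (insert v (S - {y})))"
      using steiner_dist_conn[OF assms(1,2), of "insert v (S - {y})"] S v by blast
    have "steiner_dist G S + 2 \<le> card W + length xs"
      using that W(3) by (intro steiner_dist_le_walk[OF assms(1) W(1,2) xs]) auto
    then show "d < length xs" using W(4) r[OF that] d by linarith
  qed
  have X: "?X \<noteq> {}"
  proof
    assume "?X = {}"
    then show False using cX k by (simp only: card.empty)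
  qed
  have U': "v \<in> U" "?X \<subseteq> U" using U(3) by auto
  obtain w p A B where D: "walk ?E v p w" "set p \<subseteq> U" "conn ?E A" "conn ?E B" "A \<subseteq> U" "B \<subseteq> U"
    "w \<in> A" "w \<in> B" "?X \<subseteq> A \<union> B" "card A + card B + length p \<le> card U + 2"
    "w \<in> ?X \<or> w \<notin> ?X \<and> ?X \<inter> A \<inter> B = {} \<and> ?X \<inter> A \<noteq> {} \<and> ?X \<inter> B \<noteq> {}"
    using branching_decomposition[OF sym finU U(1) U'(1,2) X] by (elim exE conjE) (rule that)
  have finAB: "finite A" "finite B" using D(5,6) finU by (auto intro: finite_subset)
  \<comment> \<open>The list \<open>p\<close> has \<open>q + 1\<close> vertices, hence
    \<open>q\<close> edges.\<close>
  obtain q where q: "length p = Suc q" using D(1) by (cases p) (auto simp: walk_def)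
  have "card A + card B = card (A \<union> B) + card (A \<inter> B)" using card_Un_Int[OF finAB] .
  moreover have "card (A \<inter> B) > 0" using D(7,8) finAB by (auto simp: card_gt_0_iff)
  ultimately have cAB: "card (A \<union> B) + q \<le> Suc r" using D(10) U(4) q by linarith
  have connAB: "conn ?E (A \<union> B)" using conn_Un[OF D(3,4,7,8)] .
  \<comment> \<open>Without the path, \<open>A \<union> B\<close> is still connected and contains
    \<open>S - {s}\<close>. By the choice of \<open>s\<close> it has more than \<open>m\<close>
    vertices, which forces \<open>q \<le> r - m\<close>.\<close>
  have "m \<le> card (A \<union> B) - 1"
    using steiner_dist_le_conn[OF assms(1) connAB _ D(9)] D(5,6) U(2) s(2) by auto
  moreover have "card (A \<union> B) > 0" using D(7) finAB by (auto simp: card_gt_0_iff)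
  ultimately have ql: "q \<le> l" using cAB \<open>m \<le> r\<close> unfolding l_def by linarith
  have UV: "A \<subseteq> ?V" "B \<subseteq> ?V" "set p \<subseteq> ?V" using D U(2) by auto
  \<comment> \<open>This removes the truncated subtractions from \<open>card S\<close>; in the
    branching case \<open>j\<close> is the coefficient of \<open>l\<close> left at the end.\<close>
  obtain j where j: "card S = j + 5" using k by (metis add.commute le_Suc_ex)
  from D(11) show ?thesis
  proof
    assume w: "w \<in> ?X"
    have dq: "d \<le> q"
      using farD[OF dvS D(1) UV(3)] w q by simp
    have cY: "card (?X - {w}) = card S - 2" using w finS cX by simp
    \<comment> \<open>The tour starts at a point of \<open>S\<close>, so every leg costs
      \<open>d + l\<close>. With \<open>k = card S\<close>, the \<open>k - 2\<close> other points of
      \<open>?X\<close> give \<open>k - 1\<close> legs.\<close>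
    have "2 * (d + l) + (card (?X - {w}) - 1) * (d + l) + 2 \<le> 2 * card (A \<union> B)"
    proof (rule conn_card_lower_bound[OF sym _ connAB, of w ?V])
      have "card (?X - {w}) \<noteq> 0" using cY k by linarith
      then show "?X - {w} \<noteq> {}" by (metis card.empty)
      show "finite (A \<union> B)" using finAB by simp
      show "w \<in> A \<union> B" "A \<union> B \<subseteq> ?V" using D(7) UV(1,2) by simp_all
      show "?X - {w} \<subseteq> A \<union> B" using D(9) by auto
      show "far ?E ?V (d + l) w y" "far ?E ?V (d + l) y w" if "y \<in> ?X - {w}" for y
        using that w by (auto intro!: dSS)
      show "far ?E ?V (d + l) y z" if "y \<in> ?X - {w}" "z \<in> ?X - {w}" "y \<noteq> z" for y z
        using that by (auto intro!: dSS)
    qed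
    then have "(j + 4) * (d + l) + 2 * q \<le> 2 * r"
      using cAB unfolding cY j by (simp add: algebra_simps)
    \<comment> \<open>As \<open>d \<le> q \<le> l\<close>, the total is at least
      \<open>(j + 4) * (2 * d) + 2 * d\<close>, which exceeds the required
      \<open>(j + 6) * d\<close> with room to spare unless \<open>d = 0\<close>.\<close>
    moreover have "(j + 4) * (d + l) \<ge> (j + 4) * (d + d)"
      using dq ql by (intro mult_le_mono) auto
    ultimately show ?thesis unfolding j using dq by (simp add: algebra_simps)
  next
    assume w: "w \<notin> ?X \<and> ?X \<inter> A \<inter> B = {} \<and> ?X \<inter> A \<noteq> {} \<and> ?X \<inter> B \<noteq> {}"
    \<comment> \<open>Truncated subtraction: for \<open>q \<ge> d\<close> the bound \<open>b\<close>
      is \<open>0\<close>, and \<open>d \<le> b + q\<close> holds in every case.\<close>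
    define b where "b = d - q"
    have dw: "far ?E ?V b w y" if "y \<in> S" for y
      unfolding far_def
    proof (intro allI impI)
      fix xs assume xs: "walk ?E w xs y" "set xs \<subseteq> ?V"
      then obtain bs where bs: "xs = w # bs" by (cases xs) (auto simp: walk_def)
      \<comment> \<open>The path \<open>p\<close>, without its last vertex \<open>w\<close>, is put
        in front of a walk from \<open>w\<close>. The result has at least \<open>d\<close> edges, of
        which \<open>q\<close> belong to \<open>p\<close>.\<close>
      have "p = butlast p @ [w]" using D(1) by (auto simp: walk_def)
      then have p: "walk ?E v (butlast p @ [w]) w" using D(1) by simp
      have "walk ?E v (butlast p @ xs) y"
        using walk_join[OF p] xs(1) unfolding bs by blast
      moreover have "set (butlast p @ xs) \<subseteq> ?V"
        using UV(3) xs(2) by (auto dest: in_set_butlastD)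
      ultimately have "d < length (butlast p @ xs)"
        by (rule farD[OF dvS[OF that]])
      then show "b < length xs" using q bs unfolding b_def by simp
    qed
    \<comment> \<open>\<open>A\<close> and \<open>B\<close> are toured separately, so the way
      between \<open>w\<close> and \<open>S\<close> is paid four times in all, at \<open>b\<close>
      each.\<close>
    have bound: "2 * b + (card (?X \<inter> C) - 1) * (d + l) + 2 \<le> 2 * card C"
      if "conn ?E C" "C \<subseteq> U" "w \<in> C" "?X \<inter> C \<noteq> {}" for C
    proof (rule conn_card_lower_bound[OF sym _ that(1,3), of ?V])
      show "finite C" by (rule finite_subset[OF that(2) finU])
      show "C \<subseteq> ?V" "?X \<inter> C \<subseteq> C" "?X \<inter> C \<noteq> {}" using that U(2) by auto
      show "far ?E ?V b y w" "far ?E ?V b w y" if "y \<in> ?X \<inter> C" for y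
        using that far_sym[OF sym dw] dw by auto
      show "far ?E ?V (d + l) y z" if "y \<in> ?X \<inter> C" "z \<in> ?X \<inter> C" "y \<noteq> z" for y z
        using that by (auto intro!: dSS)
    qed
    have "(?X \<inter> A) \<inter> (?X \<inter> B) = {}" using w by auto
    then have "card ((?X \<inter> A) \<union> (?X \<inter> B)) = card (?X \<inter> A) + card (?X \<inter> B)"
      using finS by (intro card_Un_disjoint) auto
    moreover have "(?X \<inter> A) \<union> (?X \<inter> B) = ?X" using D(9) by auto
    ultimately have "card ?X = card (?X \<inter> A) + card (?X \<inter> B)" by (simp only:)
    moreover obtain x y where xy: "card (?X \<inter> A) = Suc x" "card (?X \<inter> B) = Suc y"
    proof -
      have "0 < card (?X \<inter> A)" "0 < card (?X \<inter> B)" using w finS by (auto simp only: card_gt_0_iff)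
      then show thesis using that by (auto simp only: gr0_conv_Suc)
    qed
    ultimately have "x + y = j + 2" using cX j by simp
    \<comment> \<open>This collects the legs between points of \<open>S\<close>: \<open>x\<close>
      and \<open>y\<close> of them in the two tours, together
      \<open>card S - 3 = j + 2\<close>.\<close>
    define t where "t = (j + 2) * (d + l)"
    have sum: "x * (d + l) + y * (d + l) = t"
      using \<open>x + y = j + 2\<close> by (simp add: t_def add_mult_distrib[symmetric])
    have "4 * b + (x * (d + l) + y * (d + l)) + 4 \<le> 2 * (card A + card B)"
      using bound[OF D(3,5,7)] bound[OF D(4,6,8)] w unfolding xy by auto
    moreover have "card A + card B + q \<le> r + 2" using D(10) U(4) q by simp
    ultimately have "4 * b + t + 2 * q \<le> 2 * r" unfolding sum by arith
    moreover have "d \<le> b + q" unfolding b_def by simp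
    \<comment> \<open>From \<open>b + q \<ge> d\<close>, the part \<open>4 * b + 2 * q\<close> is at
      least \<open>4 * d - 2 * q\<close>, and \<open>q \<le> l\<close> absorbs the loss:
      \<open>(j + 6) * d + j * l \<le> 2 * r\<close>.\<close>
    ultimately show ?thesis unfolding j t_def using ql by (simp add: algebra_simps)
  qed
qed

section \<open>Radius, diameter and their ratio\<close>

theorem theorem3:
  fixes G :: "'a pair_pre_digraph" and k :: nat
  assumes "k \<ge> 5"
    and "pair_graph G"
    and "Digraph_Component.connected (with_proj G)"
    and "k \<le> card (pverts G)"
  shows "real (sdiam k G) \<le> (real k + 3) / (real k + 1) * real (srad k G)"
proof -
  interpret pair_graph G by fact
  let ?F = "\<lambda>v. {S. S \<subseteq> pverts G \<and> card S = k \<and> v \<in> S}"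
  have ne: "pverts G \<noteq> {}" using assms(1,4) by auto
  have F: "finite (?F v)" "v \<in> pverts G \<Longrightarrow> ?F v \<noteq> {}" for v
    using pair_finite_verts steiner_ecc_sets[OF assms(2), of v k] assms(1,4) by auto
  have "sdiam k G \<in> steiner_ecc k G ` pverts G"
    unfolding sdiam_def using pair_finite_verts ne by (intro Max_in) auto
  then obtain u where u: "u \<in> pverts G" "sdiam k G = steiner_ecc k G u" by auto
  have "steiner_ecc k G u \<in> steiner_dist G ` ?F u"
    unfolding steiner_ecc_def using F u(1) by (intro Max_in) auto
  then obtain S where S: "S \<subseteq> pverts G" "card S = k" "sdiam k G = steiner_dist G S"
    using u(2) by auto
  have "srad k G \<in> steiner_ecc k G ` pverts G"
    unfolding srad_def using pair_finite_verts ne by (intro Min_in) auto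
  then obtain v where v: "v \<in> pverts G" "srad k G = steiner_ecc k G v" by auto
  have r: "steiner_dist G T \<le> srad k G" if "T \<in> ?F v" for T
    unfolding v(2) steiner_ecc_def using F that by (intro Max_ge) auto
  have finS: "finite S" by (rule finite_subset[OF S(1) pair_finite_verts])
  have "(k + 1) * (sdiam k G - srad k G) \<le> 2 * srad k G"
  \<comment> \<open>If \<open>v\<close> lies in \<open>S\<close>, then \<open>S\<close> itself
    counts for the eccentricity of the centre \<open>v\<close>, so the truncated difference is
    \<open>0\<close>.\<close>
  proof (cases "v \<in> S \<or> sdiam k G \<le> srad k G")
    case True
    then show ?thesis using r[of S] S by auto
  next
    case False
    have "(card S + 1) * (sdiam k G - srad k G) \<le> 2 * srad k G"
    proof (rule steiner_dist_excess[OF assms(2,3)])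
      \<comment> \<open>Since \<open>v \<notin> S\<close>, exchanging \<open>s\<close> for
        \<open>v\<close> keeps the cardinality \<open>k\<close>, so the new set counts for the
        eccentricity of \<open>v\<close>.\<close>
      show "steiner_dist G (insert v (S - {s})) \<le> srad k G" if "s \<in> S" for s
        using that False S v(1) finS assms(1) by (intro r) (auto simp: card_insert_if)
    qed (use False S v(1) assms(1) in auto)
    then show ?thesis using S(2) by simp
  qed
  then have "real ((k + 1) * (sdiam k G - srad k G)) \<le> real (2 * srad k G)"
    by (rule of_nat_mono)
  then have "(real k + 1) * real (sdiam k G - srad k G) \<le> 2 * real (srad k G)"
    by (simp only: of_nat_mult of_nat_add of_nat_1 of_nat_numeral)
  \<comment> \<open>The truncated difference is never below the difference of the reals.\<close>
  moreover have "(real k + 1) * (real (sdiam k G) - real (srad k G))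
      \<le> (real k + 1) * real (sdiam k G - srad k G)"
    by (intro mult_left_mono) auto
  ultimately have "(real k + 1) * (real (sdiam k G) - real (srad k G)) \<le> 2 * real (srad k G)"
    by linarith
  then have "(real k + 1) * real (sdiam k G) \<le> (real k + 3) * real (srad k G)"
    by (simp add: algebra_simps)
  then show ?thesis by (simp add: field_simps)
qed

end
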